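(* Let $G=(V,E)$ be a finite simple graph with $V\neq\emptyset$ and let $\mathcal{C}\subseteq V$. If $\mathcal{C}$ is an independent set of $G$, then $\mathbf{S}(G,\mathcal{C})$ is a $(|V|-1)$-simplex with vertices $f_{\mathcal{C}}^{x}$, $x\in V$.
   Context: Graphs are simple (no loops, no multiple edges) and undirected; $x\sim y$ means $(x,y)\in E$. A set of nodes is independent if it contains no two adjacent nodes. $\Delta(V)=\{p\in\mathbb{R}^V : p_x\ge 0 \text{ for all } x\in V,\ \sum_{x\in V}p_x=1\}$ is the set of probability distributions on $V$. A point $x\in V$ is a strong mode of $p\in\Delta(V)$ if $p_x\ge\sum_{y\sim x}p_y$ (sum over all neighbors $y$ of $x$). The polytope of strong $\mathcal{C}$-modes in $G$ is $\mathbf{S}(G,\mathcal{C})=\{p\in\Delta(V): \text{every } x\in\mathcal{C}\text{ is a strong mode of } p\}$. For $x\in V$, $N_{\mathcal{C}}(x)=\{y\in\mathcal{C}: y\sim x\}$, and $f_{\mathcal{C}}^{x}\in\Delta(V)$ is the uniform distribution on $N_{\mathcal{C}}(x)\cup\{x\}$. *)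

theory Defs
  imports "HOL-Analysis.Analysis"
begin

text \<open>
  A finite simple graph with nonempty vertex set is given by a finite type \<open>'v\<close> of
  vertices and a symmetric, irreflexive adjacency relation \<open>E\<close> on it. The space of real functions on
  the vertices is \<open>real ^ 'v\<close>.
\<close>

definition simple_graph :: "('v \<Rightarrow> 'v \<Rightarrow> bool) \<Rightarrow> bool" where
  "simple_graph E \<longleftrightarrow> symp E \<and> irreflp E"

definition independent_set :: "('v \<Rightarrow> 'v \<Rightarrow> bool) \<Rightarrow> 'v set \<Rightarrow> bool" where
  "independent_set E C \<longleftrightarrow> (\<forall>x\<in>C. \<forall>y\<in>C. \<not> E x y)"

definition prob_distributions :: "(real ^ 'v::finite) set" where
  "prob_distributions = {p. (\<forall>x. p $ x \<ge> 0) \<and> (\<Sum>x\<in>UNIV. p $ x) = 1}"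

definition strong_mode :: "('v::finite \<Rightarrow> 'v \<Rightarrow> bool) \<Rightarrow> real ^ 'v \<Rightarrow> 'v \<Rightarrow> bool" where
  "strong_mode E p x \<longleftrightarrow> p $ x \<ge> (\<Sum>y | E x y. p $ y)"

definition strong_mode_polytope ::
    "('v::finite \<Rightarrow> 'v \<Rightarrow> bool) \<Rightarrow> 'v set \<Rightarrow> (real ^ 'v) set" where
  "strong_mode_polytope E C = {p \<in> prob_distributions. \<forall>x\<in>C. strong_mode E p x}"

definition nbrs_in :: "('v \<Rightarrow> 'v \<Rightarrow> bool) \<Rightarrow> 'v set \<Rightarrow> 'v \<Rightarrow> 'v set" where
  "nbrs_in E C x = {y \<in> C. E x y}"

definition uniform_dist :: "'v set \<Rightarrow> real ^ 'v::finite" where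
  "uniform_dist A = (\<chi> y. if y \<in> A then 1 / real (card A) else 0)"

definition mode_vertex :: "('v::finite \<Rightarrow> 'v \<Rightarrow> bool) \<Rightarrow> 'v set \<Rightarrow> 'v \<Rightarrow> real ^ 'v" where
  "mode_vertex E C x = uniform_dist (nbrs_in E C x \<union> {x})"

end

theory Submission
  imports Defs
begin

text \<open>
  Since neighbours of points of \<open>C\<close> lie outside \<open>C\<close>, the system \<open>p = (\<Sum>x. u x *\<^sub>R f\<^sup>x)\<close> is triangular:
  it has a unique solution \<open>u\<close>, with \<open>u y = d y * p y\<close> for \<open>y \<notin> C\<close> (\<open>d y\<close> the size of the support
  of \<open>f\<^sup>y\<close>) and \<open>u y = p y - (\<Sum>x\<sim>y. p x)\<close> for \<open>y \<in> C\<close>. Hence the \<open>f\<^sup>x\<close> are linearly independent, and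
  nonnegativity of these coordinates is exactly the strong mode condition.
\<close>

definition mode_coord :: "('v::finite \<Rightarrow> 'v \<Rightarrow> bool) \<Rightarrow> 'v set \<Rightarrow> real ^ 'v \<Rightarrow> 'v \<Rightarrow> real" where
  "mode_coord E C p y =
    (if y \<in> C then p $ y - (\<Sum>x | E y x. p $ x)
     else real (card (nbrs_in E C y \<union> {y})) * p $ y)"

lemma sum_uniform_dist:
  assumes "A \<noteq> {}"
  shows "(\<Sum>y\<in>UNIV. (uniform_dist A :: real ^ 'v::finite) $ y) = 1"
proof -
  have "(\<Sum>y\<in>UNIV. (uniform_dist A :: real ^ 'v) $ y) = (\<Sum>y\<in>A. 1 / real (card A))"
    unfolding uniform_dist_def by (simp add: sum.If_cases)
  then show ?thesis
    using assms by simp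
qed

text \<open>Each \<open>mode_vertex E C x\<close> has total mass 1, so exchanging the sums leaves
  only the weights. This translates "the weights sum to 1" into "the combination has total mass
  1".\<close>

lemma sum_comb_mode_vertex:
  "(\<Sum>y\<in>UNIV. (\<Sum>x\<in>UNIV. u x *\<^sub>R mode_vertex E C x) $ y) = sum u (UNIV :: 'v::finite set)"
proof -
  have "(\<Sum>y\<in>UNIV. (\<Sum>x\<in>UNIV. u x *\<^sub>R mode_vertex E C x) $ y)
      = (\<Sum>x\<in>UNIV. \<Sum>y\<in>UNIV. u x * mode_vertex E C x $ y)"
    unfolding sum_component vector_scaleR_component by (simp, rule sum.swap)
  also have "\<dots> = sum u UNIV"
    by (simp add: sum_distrib_left[symmetric] mode_vertex_def sum_uniform_dist)
  finally show ?thesis .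
qed

text \<open>By symmetry of \<open>E\<close>, the distributions that charge \<open>y\<close> are that
  of \<open>y\<close> itself and, if \<open>y\<close> is in \<open>C\<close>, those of the
  neighbours of \<open>y\<close>.\<close>

lemma comb_mode_vertex_nth:
  fixes E :: "'v::finite \<Rightarrow> 'v \<Rightarrow> bool"
  assumes "simple_graph E" and "independent_set E C"
  shows "(\<Sum>x\<in>UNIV. u x *\<^sub>R mode_vertex E C x) $ y =
    u y / card (nbrs_in E C y \<union> {y}) +
    (if y \<in> C then \<Sum>x | E y x. u x / card (nbrs_in E C x \<union> {x}) else 0)"
proof -
  let ?w = "\<lambda>x. u x / card (nbrs_in E C x \<union> {x})"
  have supp: "y \<in> nbrs_in E C x \<union> {x} \<longleftrightarrow> x = y \<or> y \<in> C \<and> E y x" for x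
    using assms(1) unfolding simple_graph_def nbrs_in_def by (blast dest: sympD)
  have irr: "\<not> E y y"
    using assms(1) by (auto simp: simple_graph_def irreflp_def)
  have "(\<Sum>x\<in>UNIV. u x *\<^sub>R mode_vertex E C x) $ y =
    (\<Sum>x\<in>UNIV. if x = y \<or> y \<in> C \<and> E y x then ?w x else 0)"
    unfolding sum_component vector_scaleR_component mode_vertex_def uniform_dist_def
      vec_lambda_beta supp
    by (intro sum.cong) simp_all
  also have "\<dots> = sum ?w {x. x = y \<or> y \<in> C \<and> E y x}"
    using sum.inter_filter[of UNIV ?w "\<lambda>x. x = y \<or> y \<in> C \<and> E y x"] by simp
  also have "{x. x = y \<or> y \<in> C \<and> E y x} = insert y {x. y \<in> C \<and> E y x}"
    by auto
  also have "sum ?w \<dots> = ?w y + sum ?w {x. y \<in> C \<and> E y x}"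
    using irr by (intro sum.insert) simp_all
  finally show ?thesis
    by simp
qed

text \<open>The equivalence gives both existence and uniqueness of coordinates: outside
  \<open>C\<close> each equation involves a single unknown, and the equations on \<open>C\<close>
  are then solved by substitution.\<close>

lemma comb_mode_vertex_eq_iff:
  fixes E :: "'v::finite \<Rightarrow> 'v \<Rightarrow> bool"
  assumes "simple_graph E" and "independent_set E C"
  shows "(\<Sum>x\<in>UNIV. u x *\<^sub>R mode_vertex E C x) = p \<longleftrightarrow> u = mode_coord E C p"
proof -
  let ?d = "\<lambda>x. real (card (nbrs_in E C x \<union> {x}))"
  \<comment> \<open>A point of \<open>C\<close> has no neighbour in \<open>C\<close>, so its
    distribution is the point mass.\<close>
  have d1: "?d y = 1" if "y \<in> C" for y
    using assms(2) that by (simp add: independent_set_def nbrs_in_def)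
  have d0: "?d y \<noteq> 0" for y
    by (simp add: nbrs_in_def)
  have notin: "x \<notin> C" if "y \<in> C" "E y x" for x y
    using assms(2) that by (auto simp: independent_set_def)
  have "(\<Sum>x\<in>UNIV. u x *\<^sub>R mode_vertex E C x) = p \<longleftrightarrow>
    (\<forall>y. u y / ?d y + (if y \<in> C then \<Sum>x | E y x. u x / ?d x else 0) = p $ y)"
    by (simp only: vec_eq_iff comb_mode_vertex_nth[OF assms])
  also have "\<dots> \<longleftrightarrow> (\<forall>y. u y = mode_coord E C p y)"
  proof
    assume L: "\<forall>y. u y / ?d y + (if y \<in> C then \<Sum>x | E y x. u x / ?d x else 0) = p $ y"
    have out: "u y / ?d y = p $ y" if "y \<notin> C" for y
      using L[rule_format, of y] that by simp
    show "\<forall>y. u y = mode_coord E C p y"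
    proof
      fix y
      show "u y = mode_coord E C p y"
      proof (cases "y \<in> C")
        case True
        \<comment> \<open>All neighbours of \<open>y\<close> lie outside \<open>C\<close>, where
          \<open>out\<close> applies; without \<open>Un_insert_right\<close> the supports keep the
          form in which \<open>out\<close> mentions them.\<close>
        then have "(\<Sum>x | E y x. u x / ?d x) = (\<Sum>x | E y x. p $ x)"
          by (intro sum.cong) (simp_all add: notin out del: Un_insert_right)
        then show ?thesis
          using L[rule_format, of y] True unfolding mode_coord_def d1[OF True] by simp
      next
        case False
        then show ?thesis
          using out[OF False] d0[of y] unfolding mode_coord_def by (simp add: field_simps)
      qed
    qed
  next
    assume R: "\<forall>y. u y = mode_coord E C p y"
    have out: "u y / ?d y = p $ y" if "y \<notin> C" for y
      using R d0[of y] that unfolding mode_coord_def by simp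
    show "\<forall>y. u y / ?d y + (if y \<in> C then \<Sum>x | E y x. u x / ?d x else 0) = p $ y"
    proof
      fix y
      show "u y / ?d y + (if y \<in> C then \<Sum>x | E y x. u x / ?d x else 0) = p $ y"
      proof (cases "y \<in> C")
        case True
        then have "(\<Sum>x | E y x. u x / ?d x) = (\<Sum>x | E y x. p $ x)"
          by (intro sum.cong) (simp_all add: notin out del: Un_insert_right)
        then show ?thesis
          using R True unfolding d1[OF True] by (simp add: mode_coord_def)
      next
        case False
        then show ?thesis
          using out[OF False] by simp
      qed
    qed
  qed
  finally show ?thesis
    by (simp add: fun_eq_iff)
qed

text \<open>On \<open>C\<close> the sign of the coordinate is the strong mode inequality, outside
  \<open>C\<close> it is the sign of \<open>p\<close>. Nonnegativity of \<open>p\<close> on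
  \<open>C\<close> then follows, since a strong mode in \<open>C\<close> dominates a sum of values
  outside \<open>C\<close>.\<close>

lemma mode_coord_nonneg_iff:
  assumes "independent_set E C"
  shows "(\<forall>y. 0 \<le> mode_coord E C p y) \<longleftrightarrow> (\<forall>y. 0 \<le> p $ y) \<and> (\<forall>x\<in>C. strong_mode E p x)"
proof
  assume L: "\<forall>y. 0 \<le> mode_coord E C p y"
  have modes: "\<forall>x\<in>C. strong_mode E p x"
  proof
    fix x assume "x \<in> C"
    then show "strong_mode E p x"
      using L[rule_format, of x] by (simp add: mode_coord_def strong_mode_def)
  qed
  have out: "0 \<le> p $ y" if "y \<notin> C" for y
  proof -
    have "0 < real (card (nbrs_in E C y \<union> {y}))"
      by (simp add: card_gt_0_iff)
    moreover have "0 \<le> real (card (nbrs_in E C y \<union> {y})) * p $ y"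
      using L[rule_format, of y] that unfolding mode_coord_def by (simp only: if_False)
    ultimately show ?thesis
      by (simp only: zero_le_mult_iff) linarith
  qed
  have "0 \<le> p $ y" if "y \<in> C" for y
  proof -
    have "0 \<le> (\<Sum>x | E y x. p $ x)"
      using assms that by (intro sum_nonneg out) (auto simp: independent_set_def)
    also have "\<dots> \<le> p $ y"
      using modes that by (simp add: strong_mode_def)
    finally show ?thesis .
  qed
  with out modes show "(\<forall>y. 0 \<le> p $ y) \<and> (\<forall>x\<in>C. strong_mode E p x)"
    by blast
next
  assume "(\<forall>y. 0 \<le> p $ y) \<and> (\<forall>x\<in>C. strong_mode E p x)"
  then show "\<forall>y. 0 \<le> mode_coord E C p y"
    by (simp add: mode_coord_def strong_mode_def)
qed

text \<open>By uniqueness, the coordinates of \<open>mode_vertex E C z\<close> are the indicator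
  function of \<open>z\<close>, which determines \<open>z\<close>.\<close>

lemma inj_mode_vertex:
  fixes E :: "'v::finite \<Rightarrow> 'v \<Rightarrow> bool"
  assumes "simple_graph E" and "independent_set E C"
  shows "inj (mode_vertex E C)"
proof (rule injI)
  fix x y
  assume eq: "mode_vertex E C x = mode_vertex E C y"
  have unit: "(\<lambda>w. if w = z then 1 else 0) = mode_coord E C (mode_vertex E C z)" for z
    unfolding comb_mode_vertex_eq_iff[OF assms, symmetric]
    by (simp add: if_distrib[of "\<lambda>r. r *\<^sub>R _"] cong: if_cong)
  have "(\<lambda>w. if w = x then 1 else 0 :: real) = (\<lambda>w. if w = y then 1 else 0)"
    unfolding unit eq ..
  from fun_cong[OF this, of x] show "x = y"
    by (simp split: if_splits)
qed

text \<open>A dependence would be a vanishing combination with a nonzero coefficient, but by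
  uniqueness its coefficients are the coordinates of the zero vector, all 0.\<close>

lemma affine_independent_mode_vertex:
  fixes E :: "'v::finite \<Rightarrow> 'v \<Rightarrow> bool"
  assumes "simple_graph E" and "independent_set E C"
  shows "\<not> affine_dependent (range (mode_vertex E C))"
proof
  assume "affine_dependent (range (mode_vertex E C))"
  then obtain U x where U: "U (mode_vertex E C x) \<noteq> 0"
    and "(\<Sum>v\<in>range (mode_vertex E C). U v *\<^sub>R v) = 0"
    by (auto simp: affine_dependent_explicit_finite)
  then have "(\<Sum>x\<in>UNIV. U (mode_vertex E C x) *\<^sub>R mode_vertex E C x) = 0"
    by (simp add: sum.reindex[OF inj_mode_vertex[OF assms]])
  then have "(\<lambda>x. U (mode_vertex E C x)) = mode_coord E C 0"
    by (simp only: comb_mode_vertex_eq_iff[OF assms])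
  then have "U (mode_vertex E C x) = mode_coord E C 0 x"
    by (rule fun_cong)
  also have "\<dots> = 0"
    unfolding mode_coord_def zero_index by simp
  finally show False
    using U by blast
qed

lemma strong_mode_polytope_eq_hull:
  fixes E :: "'v::finite \<Rightarrow> 'v \<Rightarrow> bool"
  assumes "simple_graph E" and "independent_set E C"
  shows "strong_mode_polytope E C = convex hull range (mode_vertex E C)"
proof (rule set_eqI)
  fix p
  let ?u = "mode_coord E C p"
  have comb: "(\<Sum>x\<in>UNIV. ?u x *\<^sub>R mode_vertex E C x) = p"
    by (simp add: comb_mode_vertex_eq_iff[OF assms])
  have sum_u: "sum ?u UNIV = (\<Sum>y\<in>UNIV. p $ y)"
    using sum_comb_mode_vertex[of ?u E C] unfolding comb ..
  \<comment> \<open>Injectivity turns sums over the range into sums over vertices, and uniqueness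
    forces the weights to be \<open>?u\<close>.\<close>
  have "p \<in> convex hull range (mode_vertex E C) \<longleftrightarrow>
    (\<exists>u. (\<forall>x. 0 \<le> u (mode_vertex E C x)) \<and> (\<Sum>x\<in>UNIV. u (mode_vertex E C x)) = 1 \<and>
      (\<lambda>x. u (mode_vertex E C x)) = ?u)"
    by (simp add: convex_hull_finite sum.reindex[OF inj_mode_vertex[OF assms]]
        flip: comb_mode_vertex_eq_iff[OF assms])
  also have "\<dots> \<longleftrightarrow> (\<forall>x. 0 \<le> ?u x) \<and> sum ?u UNIV = 1"
  proof
    assume "(\<forall>x. 0 \<le> ?u x) \<and> sum ?u UNIV = 1"
    then show "\<exists>u. (\<forall>x. 0 \<le> u (mode_vertex E C x)) \<and>
        (\<Sum>x\<in>UNIV. u (mode_vertex E C x)) = 1 \<and> (\<lambda>x. u (mode_vertex E C x)) = ?u"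
      \<comment> \<open>Hull weights are functions of points, so the coordinates are carried over
        along the inverse of the vertex map.\<close>
      by (intro exI[of _ "?u \<circ> inv (mode_vertex E C)"])
        (simp add: inv_f_f[OF inj_mode_vertex[OF assms]])
  next
    assume "\<exists>u. (\<forall>x. 0 \<le> u (mode_vertex E C x)) \<and>
        (\<Sum>x\<in>UNIV. u (mode_vertex E C x)) = 1 \<and> (\<lambda>x. u (mode_vertex E C x)) = ?u"
    then obtain u where "\<forall>x. 0 \<le> u (mode_vertex E C x)"
      "(\<Sum>x\<in>UNIV. u (mode_vertex E C x)) = 1" and eq: "(\<lambda>x. u (mode_vertex E C x)) = ?u"
      by blast
    then show "(\<forall>x. 0 \<le> ?u x) \<and> sum ?u UNIV = 1"
      unfolding eq[symmetric] by blast
  qed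
  also have "\<dots> \<longleftrightarrow> p \<in> strong_mode_polytope E C"
    unfolding mode_coord_nonneg_iff[OF assms(2)] sum_u
    by (auto simp: strong_mode_polytope_def prob_distributions_def)
  finally show "p \<in> strong_mode_polytope E C \<longleftrightarrow> p \<in> convex hull range (mode_vertex E C)" ..
qed

theorem proposition3:
  fixes E :: "'v::finite \<Rightarrow> 'v \<Rightarrow> bool" and C :: "'v set"
  assumes "simple_graph E"
    and "independent_set E C"
  shows "(int CARD('v) - 1) simplex (strong_mode_polytope E C) \<and>
    {p. p extreme_point_of (strong_mode_polytope E C)} = range (mode_vertex E C)"
proof
  note indep = affine_independent_mode_vertex[OF assms]
  \<comment> \<open>The dimension of a simplex is one less than its number of distinct
    vertices.\<close>
  have "card (range (mode_vertex E C)) = CARD('v)"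
    by (rule card_image[OF inj_mode_vertex[OF assms]])
  then show "(int CARD('v) - 1) simplex (strong_mode_polytope E C)"
    unfolding strong_mode_polytope_eq_hull[OF assms]
    by (intro simplex_convex_hull) (simp_all add: indep)
  show "{p. p extreme_point_of (strong_mode_polytope E C)} = range (mode_vertex E C)"
    unfolding strong_mode_polytope_eq_hull[OF assms]
    by (simp add: extreme_point_of_convex_hull_affine_independent[OF indep])
qed

end
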